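(* In the coordinates $x=F(\{1,2\})$, $y=F(\{1,3\})$, $z=F(\{2,3\})$, $t=F(\{1,2,3\})$, the classical profile region satisfies $$\mathfrak C_3=\mathfrak G_3\cap\{(x,y,z,t): t\le x+y+z\}.$$ Its facets are exactly the seven given by the inequalities $$t\ge x+y,\quad t\ge x+z,\quad t\ge y+z,\quad t\le1+x,\quad t\le1+y,\quad t\le1+z,\quad t\le x+y+z,$$ and its vertices are exactly $$(0,0,0,0),\ (1,0,0,1),\ (0,1,0,1),\ (0,0,1,1),\ (1,1,1,2),\ \left(\tfrac12,\tfrac12,\tfrac12,\tfrac32\right).$$
   Context: A finite-dimensional GPT state space is a nonempty compact convex subset $K$ of some $\mathbb R^d$, $d\ge1$. A (finite-outcome) measurement on $K$ is a finite family $(e_x)_{x\in X}$ of nonnegative affine functions on $K$ with $\sum_{x}e_x=1$; every such family is allowed. For a list of (not necessarily distinct) states $s_1,s_2,s_3\in K$ and nonempty $H\subseteq\{1,2,3\}$, $D(H)=\max\sum_{i\in H}e_i(s_i)$, the maximum over all measurements $(e_i)_{i\in H}$ indexed by $H$, and $F(H)=|H|-D(H)$. $F$ is the error profile of the list. The GPT region $\mathfrak G_3\subset\mathbb R^4$ is the set of all vectors $(F(\{1,2\}),F(\{1,3\}),F(\{2,3\}),F(\{1,2,3\}))$ arising from lists of three states in all finite-dimensional GPT state spaces. The classical region $\mathfrak C_3$ is the set of those vectors arising from lists of three states in the probability simplexes $K=\Delta_m=\{p\in\mathbb R^m:p_j\ge0,\ \sum_jp_j=1\}$, $m\ge1$.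 *)

theory Defs
  imports "HOL-Analysis.Analysis"
begin

text \<open>
  Points of \<open>\<real>\<^sup>d\<close> are functions \<open>nat \<Rightarrow> real\<close> vanishing from index \<open>d\<close> on, i.e. elements of the
  topological space \<^term>\<open>Euclidean_space d\<close>. This allows the dimension to be quantified over.
  Since the function space is not an instance of \<^class>\<open>real_vector\<close>, convex combinations are
  written out coordinatewise.
\<close>

type_synonym point = "nat \<Rightarrow> real"

definition mix :: "real \<Rightarrow> point \<Rightarrow> point \<Rightarrow> point" where
  "mix t p q = (\<lambda>i. (1 - t) * p i + t * q i)"

definition state_space :: "nat \<Rightarrow> point set \<Rightarrow> bool" where
  "state_space d K \<longleftrightarrow>
     K \<noteq> {} \<and> compactin (Euclidean_space d) K \<and>
     (\<forall>p\<in>K. \<forall>q\<in>K. \<forall>t\<in>{0..1}. mix t p q \<in> K)"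

definition affine_fun_on :: "point set \<Rightarrow> (point \<Rightarrow> real) \<Rightarrow> bool" where
  "affine_fun_on K f \<longleftrightarrow>
     (\<forall>p\<in>K. \<forall>q\<in>K. \<forall>t\<in>{0..1}. f (mix t p q) = (1 - t) * f p + t * f q)"

definition measurement :: "point set \<Rightarrow> 'x set \<Rightarrow> ('x \<Rightarrow> point \<Rightarrow> real) \<Rightarrow> bool" where
  "measurement K X e \<longleftrightarrow>
     finite X \<and>
     (\<forall>x\<in>X. affine_fun_on K (e x) \<and> (\<forall>p\<in>K. 0 \<le> e x p)) \<and>
     (\<forall>p\<in>K. (\<Sum>x\<in>X. e x p) = 1)"

text \<open>
  The maximum below is attained for nonempty finite \<open>H\<close>: in the topology of pointwise convergence
  the measurements on \<open>K\<close> form a closed subset of a product of copies of \<open>[0, 1]\<close>.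
\<close>

definition success :: "point set \<Rightarrow> (nat \<Rightarrow> point) \<Rightarrow> nat set \<Rightarrow> real" where
  "success K s H = (GREATEST v. \<exists>e. measurement K H e \<and> v = (\<Sum>i\<in>H. e i (s i)))"

definition err :: "point set \<Rightarrow> (nat \<Rightarrow> point) \<Rightarrow> nat set \<Rightarrow> real" where
  "err K s H = real (card H) - success K s H"

definition err_vector :: "point set \<Rightarrow> (nat \<Rightarrow> point) \<Rightarrow> real \<times> real \<times> real \<times> real" where
  "err_vector K s = (err K s {1, 2}, err K s {1, 3}, err K s {2, 3}, err K s {1, 2, 3})"

definition gpt_region :: "(real \<times> real \<times> real \<times> real) set" where
  "gpt_region =
     {err_vector K s | d K s. 1 \<le> d \<and> state_space d K \<and> (\<forall>i\<in>{1, 2, 3}. s i \<in> K)}"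

definition prob_simplex :: "nat \<Rightarrow> point set" where
  "prob_simplex m = {p. (\<forall>j<m. 0 \<le> p j) \<and> (\<forall>j\<ge>m. p j = 0) \<and> (\<Sum>j<m. p j) = 1}"

definition classical_region :: "(real \<times> real \<times> real \<times> real) set" where
  "classical_region =
     {err_vector (prob_simplex m) s | m s. 1 \<le> m \<and> (\<forall>i\<in>{1, 2, 3}. s i \<in> prob_simplex m)}"

end

theory Submission
  imports Defs
begin

text \<open>
  On a simplex the optimal success probability is the sum over the outcomes of the largest of the
  probabilities which the states give to that outcome. So only the outcome weights \<open>w A\<close>,
  \<open>{} \<noteq> A \<subseteq> {1, 2, 3}\<close>, matter for lists in which every outcome has a common probability on the
  states of \<open>A\<close> and 0 on the others. For such a list the coordinates of the error vector determine
  \<open>w\<close> linearly, and the seven conditions \<open>w A \<ge> 0\<close> are precisely the seven inequalities. Conversely,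
  six of the inequalities hold in every GPT because outcomes can be merged or added, and
  \<open>t \<le> x + y + z\<close> holds on a simplex outcome by outcome.
\<close>

section \<open>Optimal measurements\<close>

text \<open>Tychonoff's theorem for function types; it serves both for bounded families of effects
  and for the cube around a simplex.\<close>

lemma compact_Pi_UNIV:
  fixes C :: "'i \<Rightarrow> 'b::topological_space set"
  assumes "\<And>i. compact (C i)"
  shows "compact {f. \<forall>i. f i \<in> C i}"
proof -
  have "compactin (product_topology (\<lambda>_::'i. euclidean) UNIV) (PiE UNIV C)"
    using assms by (simp add: compactin_PiE)
  moreover have "PiE UNIV C = {f. \<forall>i. f i \<in> C i}"
    by auto
  ultimately show ?thesis
    by (simp add: euclidean_product_topology)
qed

lemma affine_fun_on_cong:
  assumes "affine_fun_on K f" "\<And>p. p \<in> K \<Longrightarrow> f p = g p"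
    and "\<And>p q t. p \<in> K \<Longrightarrow> q \<in> K \<Longrightarrow> t \<in> {0..1} \<Longrightarrow> mix t p q \<in> K"
  shows "affine_fun_on K g"
  using assms unfolding affine_fun_on_def by metis

lemma affine_fun_on_add:
  "affine_fun_on K f \<Longrightarrow> affine_fun_on K g \<Longrightarrow> affine_fun_on K (\<lambda>p. f p + g p)"
  by (simp add: affine_fun_on_def algebra_simps)

lemma measurement_le_1:
  assumes "measurement K H e" "i \<in> H" "p \<in> K"
  shows "e i p \<le> 1"
proof -
  have "e i p \<le> (\<Sum>x\<in>H. e x p)"
    using assms by (intro member_le_sum) (auto simp: measurement_def)
  then show ?thesis
    using assms by (simp add: measurement_def)
qed

text \<open>\<open>measurement\<close> leaves values outside \<open>H\<close> and \<open>K\<close>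
  free, so the set of its solutions is not compact. Setting those values to 0 moves them into a
  compact product, where the measurement conditions are closed and the score is continuous.\<close>

lemma optimal_measurement_exists:
  assumes K: "state_space d K" and H: "finite H" "H \<noteq> {}" and s: "\<And>i. i \<in> H \<Longrightarrow> s i \<in> K"
  obtains e where "measurement K H e"
    "\<And>e'. measurement K H e' \<Longrightarrow> (\<Sum>i\<in>H. e' i (s i)) \<le> (\<Sum>i\<in>H. e i (s i))"
proof -
  have mixK: "mix t p q \<in> K" if "p \<in> K" "q \<in> K" "t \<in> {0..1}" for t p q
    using K that by (simp add: state_space_def)
  define B where "B = {e::'a \<Rightarrow> point \<Rightarrow> real.
      \<forall>i. e i \<in> {g. \<forall>p. g p \<in> (if i \<in> H \<and> p \<in> K then {0..1} else {0})}}"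
  have "compact B"
    unfolding B_def by (intro compact_Pi_UNIV) auto
  have coord: "continuous_on A (\<lambda>e::'a \<Rightarrow> point \<Rightarrow> real. e i p)" for A i p
    by (rule continuous_on_subset[OF continuous_on_product_then_coordinatewise
          [OF continuous_on_product_coordinates] subset_UNIV])
  have "closed {e::'a \<Rightarrow> point \<Rightarrow> real. measurement K H e}"
    unfolding measurement_def affine_fun_on_def Ball_def
    using H(1)
    by (intro closed_Collect_conj closed_Collect_all closed_Collect_imp closed_Collect_eq
        closed_Collect_le continuous_intros coord) auto
  then have cM: "compact (B \<inter> {e. measurement K H e})"
    using \<open>compact B\<close> by (rule compact_Int_closed[rotated])
  obtain h where h: "h \<in> H"
    using H by blast
  \<comment> \<open>Always answering \<open>h\<close> is a measurement.\<close>
  have "(\<lambda>i p. if i = h \<and> p \<in> K then 1 else 0) \<in> B \<inter> {e. measurement K H e}"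
    using h H(1) mixK by (auto simp: B_def measurement_def affine_fun_on_def sum.delta)
  then have ne: "B \<inter> {e. measurement K H e} \<noteq> {}"
    by blast
  have "continuous_on (B \<inter> {e. measurement K H e}) (\<lambda>e. \<Sum>i\<in>H. e i (s i))"
    by (intro continuous_intros coord)
  from continuous_attains_sup[OF cM ne this] obtain e where
    e: "e \<in> B \<inter> {e. measurement K H e}" and
    max: "\<forall>e'\<in>B \<inter> {e. measurement K H e}. (\<Sum>i\<in>H. e' i (s i)) \<le> (\<Sum>i\<in>H. e i (s i))"
    by (elim bexE)
  show thesis
  proof (rule that)
    show "measurement K H e"
      by (rule CollectD[OF IntD2[OF e]])
  next
    fix e' assume e': "measurement K H e'"
    define f where "f = (\<lambda>i p. if i \<in> H \<and> p \<in> K then e' i p else 0)"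
    have "affine_fun_on K (f i)" if "i \<in> H" for i
      by (rule affine_fun_on_cong[of K "e' i"])
        (use e' that mixK in \<open>simp_all add: f_def measurement_def\<close>)
    then have "measurement K H f"
      using e' by (auto simp: measurement_def f_def)
    moreover have "f \<in> B"
      using e' measurement_le_1[OF e'] by (auto simp: B_def f_def measurement_def)
    ultimately have "f \<in> B \<inter> {e. measurement K H e}"
      by simp
    with max have "(\<Sum>i\<in>H. f i (s i)) \<le> (\<Sum>i\<in>H. e i (s i))"
      by (rule bspec)
    then show "(\<Sum>i\<in>H. e' i (s i)) \<le> (\<Sum>i\<in>H. e i (s i))"
      using s by (simp add: f_def)
  qed
qed

text \<open>The only access to \<open>GREATEST\<close>; everything later works with an attained
  upper bound.\<close>

lemma success_eqI:
  assumes "measurement K H e" "(\<Sum>i\<in>H. e i (s i)) = v"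
    and "\<And>e'. measurement K H e' \<Longrightarrow> (\<Sum>i\<in>H. e' i (s i)) \<le> v"
  shows "success K s H = v"
  unfolding success_def using assms by (intro Greatest_equality) auto

lemma success_maximal:
  assumes "state_space d K" "finite H" "H \<noteq> {}" "\<And>i. i \<in> H \<Longrightarrow> s i \<in> K"
  shows "\<exists>e. measurement K H e \<and> success K s H = (\<Sum>i\<in>H. e i (s i))"
    and "measurement K H e' \<Longrightarrow> (\<Sum>i\<in>H. e' i (s i)) \<le> success K s H"
proof -
  have "(\<exists>e. measurement K H e \<and> success K s H = (\<Sum>i\<in>H. e i (s i))) \<and>
      (measurement K H e' \<longrightarrow> (\<Sum>i\<in>H. e' i (s i)) \<le> success K s H)"
  proof (rule optimal_measurement_exists[OF assms])
    fix e assume e: "measurement K H e"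
      and max: "\<And>e'. measurement K H e' \<Longrightarrow> (\<Sum>i\<in>H. e' i (s i)) \<le> (\<Sum>i\<in>H. e i (s i))"
    have "success K s H = (\<Sum>i\<in>H. e i (s i))"
      using e max by (intro success_eqI[of K H e s]) simp_all
    then show ?thesis
      using e max[of e'] by auto
  qed
  then show "\<exists>e. measurement K H e \<and> success K s H = (\<Sum>i\<in>H. e i (s i))"
    and "measurement K H e' \<Longrightarrow> (\<Sum>i\<in>H. e' i (s i)) \<le> success K s H"
    by simp_all
qed

text \<open>Outcomes that never occur can be added: the new effects are 0. In terms of errors this
  gives t \<le> 1 + x and its analogues.\<close>

lemma success_mono:
  assumes K: "state_space d K" and H: "finite H'" "H \<subseteq> H'" "H \<noteq> {}"
    and s: "\<And>i. i \<in> H' \<Longrightarrow> s i \<in> K"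
  shows "success K s H \<le> success K s H'"
proof -
  have fin: "finite H"
    using H finite_subset by blast
  obtain e where e: "measurement K H e" "success K s H = (\<Sum>i\<in>H. e i (s i))"
    using success_maximal(1)[OF K fin H(3), of s] s H(2) by blast
  define f where "f = (\<lambda>i p. if i \<in> H then e i p else 0)"
  have sum_f: "(\<Sum>i\<in>H'. f i (p i)) = (\<Sum>i\<in>H. e i (p i))" for p
    unfolding f_def using H by (simp add: sum.If_cases Int_absorb1)
  \<comment> \<open>At a constant family, \<open>sum_f\<close> is the normalisation of
    \<open>f\<close>.\<close>
  have "measurement K H' f"
    using e(1) H sum_f[of "\<lambda>_. _"]
    by (auto simp: measurement_def f_def affine_fun_on_def)
  then have "(\<Sum>i\<in>H'. f i (s i)) \<le> success K s H'"
    using success_maximal(2)[OF K H(1), of s f] H s by blast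
  then show ?thesis
    using e(2) by (simp add: sum_f)
qed

text \<open>Merging outcome \<open>k\<close> into \<open>i\<close> and merging outcome \<open>j\<close> into \<open>i\<close> turns an optimal three-outcome
  measurement into measurements for the two pairs; the outcomes merged into \<open>i\<close> sum to the extra 1.\<close>

lemma success_pairs_ge:
  assumes K: "state_space d K" and s: "s i \<in> K" "s j \<in> K" "s k \<in> K"
    and dist: "i \<noteq> j" "i \<noteq> k" "j \<noteq> k"
  shows "1 + success K s {i, j, k} \<le> success K s {i, j} + success K s {i, k}"
proof -
  have "s l \<in> K" if "l \<in> {i, j, k}" for l
    using s that by blast
  then obtain e where e: "measurement K {i, j, k} e"
    "success K s {i, j, k} = (\<Sum>l\<in>{i, j, k}. e l (s l))"
    using success_maximal(1)[OF K, of "{i, j, k}" s] by blast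
  have aff: "affine_fun_on K (e i)" "affine_fun_on K (e j)" "affine_fun_on K (e k)"
    using e(1) by (simp_all add: measurement_def)
  have nonneg: "0 \<le> e i p" "0 \<le> e j p" "0 \<le> e k p" and one: "e i p + e j p + e k p = 1"
    if "p \<in> K" for p
    using e(1) dist that by (simp_all add: measurement_def add.assoc)
  define f where "f = e(i := \<lambda>p. e i p + e k p)"
  define g where "g = e(i := \<lambda>p. e i p + e j p)"
  have f: "f i = (\<lambda>p. e i p + e k p)" "f j = e j"
    and g: "g i = (\<lambda>p. e i p + e j p)" "g k = e k"
    using dist by (simp_all add: f_def g_def)
  have "measurement K {i, j} f"
    unfolding measurement_def using dist aff nonneg one
    by (simp add: f affine_fun_on_add add_ac)
  then have "(\<Sum>l\<in>{i, j}. f l (s l)) \<le> success K s {i, j}"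
    using success_maximal(2)[OF K, of "{i, j}" s f] s by blast
  moreover have "measurement K {i, k} g"
    unfolding measurement_def using dist aff nonneg one
    by (simp add: g affine_fun_on_add add_ac)
  then have "(\<Sum>l\<in>{i, k}. g l (s l)) \<le> success K s {i, k}"
    using success_maximal(2)[OF K, of "{i, k}" s g] s by blast
  ultimately show ?thesis
    using dist one[OF s(1)] by (simp add: e(2) f g)
qed

section \<open>Probability simplexes\<close>

definition vertex :: "nat \<Rightarrow> point" where
  "vertex j = (\<lambda>i. if i = j then 1 else 0)"

lemma vertex_in_prob_simplex: "j < m \<Longrightarrow> vertex j \<in> prob_simplex m"
  by (auto simp: vertex_def prob_simplex_def)

lemma mix_in_prob_simplex:
  assumes "p \<in> prob_simplex m" "q \<in> prob_simplex m" "t \<in> {0..1}"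
  shows "mix t p q \<in> prob_simplex m"
  using assms by (auto simp: prob_simplex_def mix_def sum.distrib simp flip: sum_distrib_left)

text \<open>Points vanish beyond their dimension, so the simplexes are nested. This lets the
  induction below restrict an affine function to the smaller simplex.\<close>

lemma prob_simplex_mono: "m \<le> n \<Longrightarrow> prob_simplex m \<subseteq> prob_simplex n"
proof
  fix p assume mn: "m \<le> n" and p: "p \<in> prob_simplex m"
  have "(\<Sum>j<n. p j) = (\<Sum>j<m. p j)"
    using mn p by (intro sum.mono_neutral_right) (auto simp: prob_simplex_def)
  then show "p \<in> prob_simplex n"
    using p mn by (auto simp: prob_simplex_def) (metis le_less_linear order_refl)
qed

lemma prob_simplex_le_1:
  assumes "p \<in> prob_simplex m"
  shows "p j \<in> {0..1}"
proof (cases "j < m")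
  case True
  then have "p j \<le> (\<Sum>j<m. p j)"
    using assms by (intro member_le_sum) (auto simp: prob_simplex_def)
  then show ?thesis
    using assms True by (auto simp: prob_simplex_def)
qed (use assms in \<open>auto simp: prob_simplex_def\<close>)

text \<open>The simplex is closed and lies in the compact cube of functions with values in [0, 1];
  vanishing from \<open>m\<close> on places it in \<open>Euclidean_space m\<close>.\<close>

lemma state_space_prob_simplex:
  assumes "1 \<le> m"
  shows "state_space m (prob_simplex m)"
proof -
  have "closed (prob_simplex m)"
    unfolding prob_simplex_def
    by (intro closed_Collect_conj closed_Collect_all closed_Collect_imp closed_Collect_eq
        closed_Collect_le continuous_intros continuous_on_product_coordinates) auto
  moreover have "prob_simplex m \<subseteq> {p. \<forall>i. p i \<in> {0..1}}"
    using prob_simplex_le_1 by blast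
  moreover have "compact {p::point. \<forall>i. p i \<in> {0..1}}"
    by (rule compact_Pi_UNIV) auto
  ultimately have "compact (prob_simplex m)"
    by (metis compact_Int_closed inf.absorb2)
  then have "compactin (Euclidean_space m) (prob_simplex m)"
    unfolding Euclidean_space_def euclidean_product_topology compactin_subtopology
    by (auto simp: prob_simplex_def)
  then show ?thesis
    using vertex_in_prob_simplex[of 0 m] assms mix_in_prob_simplex
    by (auto simp: state_space_def)
qed

text \<open>\<open>affine_fun_on\<close> speaks only of mixtures of two points, so the induction
  peels off the last vertex.\<close>

lemma affine_fun_on_prob_simplex:
  assumes "affine_fun_on (prob_simplex m) f" "p \<in> prob_simplex m"
  shows "f p = (\<Sum>j<m. p j * f (vertex j))"
  using assms
proof (induction m arbitrary: p)
  case 0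
  then show ?case by (simp add: prob_simplex_def)
next
  case (Suc m)
  show ?case
  proof (cases "p m = 1")
    case True
    have "(\<Sum>j<m. p j) = 0" "\<forall>j<m. 0 \<le> p j"
      using Suc.prems(2) True by (auto simp: prob_simplex_def)
    then have p0: "p j = 0" if "j < m" for j
      using that by (subst (asm) sum_nonneg_eq_0_iff) auto
    then have "p = vertex m"
      using Suc.prems(2) True
      by (auto simp: vertex_def prob_simplex_def fun_eq_iff)
        (metis Suc_leI linorder_neqE_nat)
    then show ?thesis
      using True p0 by simp
  next
    case False
    \<comment> \<open>\<open>q\<close> is \<open>p\<close> conditioned on the outcome not being
      \<open>m\<close>; hence the separate case \<open>p m = 1\<close>.\<close>
    define q where "q = (\<lambda>j. if j < m then p j / (1 - p m) else 0)"
    have pm: "p m \<in> {0..1}" "1 - p m > 0"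
      using prob_simplex_le_1[OF Suc.prems(2), of m] False by auto
    have "(\<Sum>j<m. q j) = (\<Sum>j<m. p j) / (1 - p m)"
      by (simp add: q_def sum_divide_distrib)
    also have "(\<Sum>j<m. p j) = 1 - p m"
      using Suc.prems(2) by (simp add: prob_simplex_def)
    finally have q: "q \<in> prob_simplex m"
      using pm Suc.prems(2) by (auto simp: prob_simplex_def q_def)
    have "mix (p m) q (vertex m) j = p j" for j
      using pm Suc.prems(2)
      by (cases j m rule: linorder_cases) (auto simp: mix_def q_def vertex_def prob_simplex_def)
    then have p: "p = mix (p m) q (vertex m)"
      by (simp add: fun_eq_iff)
    have sub: "prob_simplex m \<subseteq> prob_simplex (Suc m)"
      by (simp add: prob_simplex_mono)
    have "f q = (\<Sum>j<m. q j * f (vertex j))"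
      using Suc.IH[OF _ q] Suc.prems(1) sub unfolding affine_fun_on_def by blast
    then have "(1 - p m) * f q = (\<Sum>j<m. p j * f (vertex j))"
      using pm by (simp add: sum_distrib_left q_def)
    moreover have "f p = (1 - p m) * f q + p m * f (vertex m)"
      using Suc.prems(1) q sub pm(1) vertex_in_prob_simplex[of m "Suc m"]
      by (subst p) (auto simp: affine_fun_on_def)
    ultimately show ?thesis
      by simp
  qed
qed

text \<open>The maximum-likelihood rule is optimal.\<close>

lemma success_prob_simplex:
  assumes H: "finite H" "H \<noteq> {}" and s: "\<And>i. i \<in> H \<Longrightarrow> s i \<in> prob_simplex m"
  shows "success (prob_simplex m) s H = (\<Sum>j<m. Max ((\<lambda>i. s i j) ` H))"
proof -
  have "\<exists>i. i \<in> H \<and> s i j = Max ((\<lambda>i. s i j) ` H)" for j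
    using Max_in[of "(\<lambda>i. s i j) ` H"] H by fastforce
  then obtain c where c: "\<And>j. c j \<in> H" "\<And>j. s (c j) j = Max ((\<lambda>i. s i j) ` H)"
    by metis
  \<comment> \<open>\<open>c j\<close> is a state giving outcome \<open>j\<close> its largest
    probability; \<open>e i\<close> collects the outcomes decided in favour of
    \<open>i\<close>.\<close>
  define e where "e = (\<lambda>i (p::point). \<Sum>j<m. if c j = i then p j else 0)"
  have sum_e: "(\<Sum>i\<in>H. e i (q i)) = (\<Sum>j<m. q (c j) j)" for q
    unfolding e_def using H(1) c(1) by (subst sum.swap) (simp add: sum.delta')
  show ?thesis
  proof (rule success_eqI[of _ _ e])
    have "affine_fun_on (prob_simplex m) (e i)" for i
      by (auto simp: affine_fun_on_def e_def mix_def sum_distrib_left simp flip: sum.distrib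
          intro!: sum.cong)
    then show "measurement (prob_simplex m) H e"
      using H(1) sum_e[of "\<lambda>_. _"]
      by (auto simp: measurement_def) (auto simp: e_def prob_simplex_def intro!: sum_nonneg)
    show "(\<Sum>i\<in>H. e i (s i)) = (\<Sum>j<m. Max ((\<lambda>i. s i j) ` H))"
      by (simp add: sum_e c(2))
  next
    fix e' assume e': "measurement (prob_simplex m) H e'"
    have "(\<Sum>i\<in>H. e' i (s i)) = (\<Sum>i\<in>H. \<Sum>j<m. s i j * e' i (vertex j))"
      using e' s by (intro sum.cong refl affine_fun_on_prob_simplex) (auto simp: measurement_def)
    also have "\<dots> = (\<Sum>j<m. \<Sum>i\<in>H. s i j * e' i (vertex j))"
      by (rule sum.swap)
    \<comment> \<open>At each vertex the effects sum to 1, so once \<open>s i j\<close> is replaced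
      by the maximum only that maximum remains.\<close>
    also have "\<dots> \<le> (\<Sum>j<m. \<Sum>i\<in>H. Max ((\<lambda>i. s i j) ` H) * e' i (vertex j))"
      using e' H(1) vertex_in_prob_simplex
      by (intro sum_mono mult_right_mono) (auto simp: measurement_def)
    also have "\<dots> = (\<Sum>j<m. Max ((\<lambda>i. s i j) ` H))"
      using e' vertex_in_prob_simplex
      by (intro sum.cong refl) (auto simp: measurement_def simp flip: sum_distrib_left)
    finally show "(\<Sum>i\<in>H. e' i (s i)) \<le> (\<Sum>j<m. Max ((\<lambda>i. s i j) ` H))" .
  qed
qed

section \<open>The profile polytope\<close>

definition profile_polytope :: "(real \<times> real \<times> real \<times> real) set" where
  "profile_polytope = {(x, y, z, t). x + y \<le> t \<and> x + z \<le> t \<and> y + z \<le> t \<and>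
     t \<le> 1 + x \<and> t \<le> 1 + y \<and> t \<le> 1 + z \<and> t \<le> x + y + z}"

lemma gpt_region_subset:
  "gpt_region \<inter> {(x, y, z, t). t \<le> x + y + z} \<subseteq> profile_polytope"
proof -
  have "(x, y, z, t) \<in> profile_polytope"
    if xyzt: "(x, y, z, t) = err_vector K s" "t \<le> x + y + z"
      and K: "state_space d K" and s: "\<forall>i\<in>{1, 2, 3}. s i \<in> K" for x y z t d K s
  proof -
    \<comment> \<open>The state shared by the two pairs comes first. In terms of errors these read x
      + y \<le> t, x + z \<le> t and y + z \<le> t.\<close>
    have "1 + success K s {1, 2, 3} \<le> success K s {1, 2} + success K s {1, 3}"
      "1 + success K s {2, 1, 3} \<le> success K s {2, 1} + success K s {2, 3}"
      "1 + success K s {3, 1, 2} \<le> success K s {3, 1} + success K s {3, 2}"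
      using s by (auto intro!: success_pairs_ge[OF K])
    moreover have "success K s {1, 2} \<le> success K s {1, 2, 3}"
      "success K s {1, 3} \<le> success K s {1, 2, 3}" "success K s {2, 3} \<le> success K s {1, 2, 3}"
      using s by (auto intro!: success_mono[OF K])
    ultimately show ?thesis
      using xyzt by (simp add: profile_polytope_def err_vector_def err_def insert_commute)
  qed
  then show ?thesis
    unfolding gpt_region_def by (auto; blast)
qed

lemma classical_region_subset:
  "classical_region \<subseteq> gpt_region \<inter> {(x, y, z, t). t \<le> x + y + z}"
proof
  fix v assume "v \<in> classical_region"
  then obtain m s where v: "v = err_vector (prob_simplex m) s" and m: "1 \<le> m"
    and s: "\<forall>i\<in>{1, 2, 3}. s i \<in> prob_simplex m"
    by (auto simp: classical_region_def)
  have D: "success (prob_simplex m) s H = (\<Sum>j<m. Max ((\<lambda>i. s i j) ` H))"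
    if "H \<noteq> {}" "H \<subseteq> {1, 2, 3}" for H
    using s that by (intro success_prob_simplex) (auto intro: finite_subset)
  have total: "(\<Sum>j<m. s 1 j) = 1" "(\<Sum>j<m. s 2 j) = 1" "(\<Sum>j<m. s 3 j) = 1"
    using s unfolding prob_simplex_def by blast+
  have "success (prob_simplex m) s {1, 2} + success (prob_simplex m) s {1, 3}
      + success (prob_simplex m) s {2, 3}
    = (\<Sum>j<m. max (s 1 j) (s 2 j) + max (s 1 j) (s 3 j) + max (s 2 j) (s 3 j))"
    by (simp add: D sum.distrib)
  also have "\<dots> \<le> (\<Sum>j<m. max (s 1 j) (max (s 2 j) (s 3 j)) + s 1 j + s 2 j + s 3 j)"
    using s by (intro sum_mono) (auto simp: max_def prob_simplex_def)
  also have "\<dots> = success (prob_simplex m) s {1, 2, 3} + 3"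
    using total by (simp add: D sum.distrib)
  finally have "v \<in> {(x, y, z, t). t \<le> x + y + z}"
    by (simp add: v err_vector_def err_def)
  moreover have "v \<in> gpt_region"
    using v m s state_space_prob_simplex unfolding gpt_region_def by blast
  ultimately show "v \<in> gpt_region \<inter> {(x, y, z, t). t \<le> x + y + z}"
    by blast
qed

text \<open>The seven inequalities say exactly that the seven weights below are nonnegative. The outcomes
  are indexed by the nonempty \<open>A \<subseteq> {1, 2, 3}\<close>, in the order 1, 2, 3, 12, 13, 23, 123; all states
  \<open>s i\<close> with \<open>i \<in> A\<close> give outcome \<open>A\<close> the same probability, the others give it probability 0.\<close>

lemma profile_polytope_subset: "profile_polytope \<subseteq> classical_region"
proof
  fix v assume "v \<in> profile_polytope"
  then obtain x y z t where v: "v = (x, y, z, t)"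
    and ineqs: "x + y \<le> t" "x + z \<le> t" "y + z \<le> t" "t \<le> 1 + x" "t \<le> 1 + y" "t \<le> 1 + z"
      "t \<le> x + y + z"
    by (auto simp: profile_polytope_def)
  \<comment> \<open>The solution of a linear system: x = w12 + w123, likewise for y and z, all
    weights add up to 3 - t, and the weights seen by each single state add up to 1.\<close>
  define w where
    "w = [1 - t + z, 1 - t + y, 1 - t + x, t - y - z, t - x - z, t - x - y, x + y + z - t]"
  define A :: "nat set list" where "A = [{1}, {2}, {3}, {1, 2}, {1, 3}, {2, 3}, {1, 2, 3}]"
  \<comment> \<open>The guard keeps list access in range and makes the states vanish from index 7
    on.\<close>
  define s where "s = (\<lambda>i j. if j < 7 \<and> i \<in> A ! j then w ! j else 0)"
  have s: "\<forall>i\<in>{1, 2, 3}. s i \<in> prob_simplex 7"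
    using ineqs
    by (auto simp: prob_simplex_def s_def A_def w_def eval_nat_numeral less_Suc_eq)
  have D: "success (prob_simplex 7) s H = (\<Sum>j<7. Max ((\<lambda>i. s i j) ` H))"
    if "H \<noteq> {}" "H \<subseteq> {1, 2, 3}" for H
    using s that by (intro success_prob_simplex) (auto intro: finite_subset)
  have "v = err_vector (prob_simplex 7) s"
    using ineqs
    by (simp add: v err_vector_def err_def D, simp add: s_def A_def w_def eval_nat_numeral)
  then show "v \<in> classical_region"
    unfolding classical_region_def using s by fastforce
qed

text \<open>The three inclusions form a cycle through the cut GPT region.\<close>

lemma classical_region_eq: "classical_region = profile_polytope"
  using gpt_region_subset classical_region_subset profile_polytope_subset by blast

section \<open>Facets and vertices\<close>

text \<open>Each hyperplane contains a point at which all other inequalities are strict, on the segment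
  from \<open>q\<close> to \<open>w\<close>; so the facets of different inequalities differ.\<close>

lemma facets_of_irredundant_halfspaces:
  fixes I :: "('a::euclidean_space \<times> real) set"
  assumes fin: "finite I" and S: "S = {x. \<forall>(a, b)\<in>I. a \<bullet> x \<le> b}"
    and q: "\<forall>(a, b)\<in>I. a \<bullet> q < b"
    and w: "\<And>a b. (a, b) \<in> I \<Longrightarrow> \<exists>w. b < a \<bullet> w \<and> (\<forall>(a', b')\<in>I - {(a, b)}. a' \<bullet> w \<le> b')"
  shows "{F. F facet_of S} = (\<lambda>(a, b). S \<inter> {x. a \<bullet> x = b}) ` I"
    and "card {F. F facet_of S} = card I"
proof -
  define hs where "hs = (\<lambda>i::'a \<times> real. {x. fst i \<bullet> x \<le> snd i})"
  have S': "S = \<Inter> (hs ` I)"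
    by (fastforce simp: S hs_def)
  have qi: "fst i \<bullet> q < snd i" if "i \<in> I" for i
    using q that by auto
  have wi: "\<exists>w. snd i < fst i \<bullet> w \<and> (\<forall>j\<in>I - {i}. fst j \<bullet> w \<le> snd j)" if "i \<in> I" for i
    using w[of "fst i" "snd i"] that by (auto simp: case_prod_unfold)
  have inj: "inj_on hs I"
  proof (rule inj_onI, rule ccontr)
    fix i j assume ij: "i \<in> I" "j \<in> I" "hs i = hs j" "i \<noteq> j"
    with wi[of i] obtain w where "snd i < fst i \<bullet> w" "fst j \<bullet> w \<le> snd j"
      by blast
    with ij(3) show False
      by (auto simp: hs_def set_eq_iff not_le[symmetric])
  qed
  \<comment> \<open>\<open>facet_of_polyhedron_explicit\<close> takes normals and bounds as
    functions of the halfspaces; injectivity of \<open>hs\<close> recovers them.\<close>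
  define r where "r = inv_into I hs"
  have r: "r (hs i) = i" if "i \<in> I" for i
    using that inj by (simp add: r_def)
  \<comment> \<open>The strict inequalities make \<open>q\<close> an interior point, so
    \<open>S\<close> is full-dimensional.\<close>
  have "open (\<Inter>i\<in>I. {x. fst i \<bullet> x < snd i})"
    using fin by (intro open_INT) (auto intro: open_halfspace_lt)
  moreover have "(\<Inter>i\<in>I. {x. fst i \<bullet> x < snd i}) \<subseteq> S"
    by (force simp: S intro: less_imp_le)
  ultimately have "q \<in> interior S"
    using qi by (intro interiorI) auto
  then have aff: "affine hull S = UNIV"
    using affine_hull_nonempty_interior by blast
  have facet: "F facet_of S \<longleftrightarrow>
      (\<exists>h. h \<in> hs ` I \<and> F = S \<inter> {x. fst (r h) \<bullet> x = snd (r h)})" for F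
  proof (rule facet_of_polyhedron_explicit)
    show "finite (hs ` I)"
      using fin by simp
    show "S = affine hull S \<inter> \<Inter> (hs ` I)"
      using aff S' by simp
  next
    fix h assume "h \<in> hs ` I"
    then obtain i where i: "i \<in> I" "h = hs i"
      by blast
    \<comment> \<open>With a zero normal, \<open>q\<close> would force a positive bound and
      \<open>w\<close> a negative one.\<close>
    moreover have "fst i \<noteq> 0"
    proof
      assume "fst i = 0"
      then show False
        using wi[OF i(1)] qi[OF i(1)] by auto
    qed
    ultimately show "fst (r h) \<noteq> 0 \<and> h = {x. fst (r h) \<bullet> x \<le> snd (r h)}"
      using r by (simp add: hs_def)
  next
    \<comment> \<open>Dropping the halfspace of \<open>i\<close> admits the point \<open>w\<close>
      that violates only that one.\<close>
    fix F' assume F': "F' \<subset> hs ` I"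
    then obtain i where i: "i \<in> I" "hs i \<notin> F'"
      by blast
    with wi obtain w where w: "snd i < fst i \<bullet> w" "\<forall>j\<in>I - {i}. fst j \<bullet> w \<le> snd j"
      by blast
    have "w \<in> h" if h: "h \<in> F'" for h
    proof -
      obtain j where "j \<in> I" "h = hs j"
        using F' h by blast
      moreover have "j \<noteq> i"
        using calculation h i(2) by blast
      ultimately show ?thesis
        using w(2) by (simp add: hs_def)
    qed
    then have "w \<in> \<Inter>F'"
      by blast
    moreover have "w \<notin> hs i"
      using w(1) by (simp add: hs_def)
    then have "w \<notin> S"
      using i(1) S' by blast
    moreover have "S \<subseteq> \<Inter>F'"
      using F' S' by blast
    ultimately show "S \<subset> affine hull S \<inter> \<Inter>F'"
      using aff by auto
  qed
  have eq: "{F. F facet_of S} = (\<lambda>i. S \<inter> {x. fst i \<bullet> x = snd i}) ` I"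
    using r by (auto simp: facet)
  then show "{F. F facet_of S} = (\<lambda>(a, b). S \<inter> {x. a \<bullet> x = b}) ` I"
    by (simp add: case_prod_unfold)
  have "inj_on (\<lambda>i. S \<inter> {x. fst i \<bullet> x = snd i}) I"
  proof (rule inj_onI, rule ccontr)
    fix i j assume ij: "i \<in> I" "j \<in> I" "i \<noteq> j"
      and same: "S \<inter> {x. fst i \<bullet> x = snd i} = S \<inter> {x. fst j \<bullet> x = snd j}"
    obtain w where w: "snd i < fst i \<bullet> w" "\<forall>j\<in>I - {i}. fst j \<bullet> w \<le> snd j"
      using wi[OF ij(1)] by blast
    \<comment> \<open>The parameter at which the segment from \<open>q\<close> to \<open>w\<close>
      crosses the hyperplane of \<open>i\<close>.\<close>
    define u where "u = (snd i - fst i \<bullet> q) / (fst i \<bullet> w - fst i \<bullet> q)"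
    define p where "p = (1 - u) *\<^sub>R q + u *\<^sub>R w"
    have u: "0 < u" "u < 1"
      using qi[OF ij(1)] w(1) by (auto simp: u_def divide_simps)
    have "fst i \<bullet> p = fst i \<bullet> q + u * (fst i \<bullet> w - fst i \<bullet> q)"
      by (simp add: p_def inner_add_right algebra_simps)
    then have pi: "fst i \<bullet> p = snd i"
      using qi[OF ij(1)] w(1) by (simp add: u_def)
    have pk: "fst k \<bullet> p < snd k" if "k \<in> I" "k \<noteq> i" for k
    proof -
      have "(1 - u) * (fst k \<bullet> q) < (1 - u) * snd k" "u * (fst k \<bullet> w) \<le> u * snd k"
        using qi[OF that(1)] w(2) that u by auto
      then show ?thesis
        by (simp add: p_def inner_add_right algebra_simps)
    qed
    have "fst k \<bullet> p \<le> snd k" if "k \<in> I" for k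
      using pi pk that by (cases "k = i") (auto intro: less_imp_le)
    then have "p \<in> S"
      by (force simp: S)
    then have "p \<in> S \<inter> {x. fst j \<bullet> x = snd j}"
      using pi unfolding same[symmetric] by simp
    then show False
      using pk[of j] ij by simp
  qed
  then show "card {F. F facet_of S} = card I"
    by (simp add: eq card_image)
qed

section \<open>Facets of the profile polytope\<close>

definition profile_halfspaces :: "((real \<times> real \<times> real \<times> real) \<times> real) set" where
  "profile_halfspaces =
     {((1, 1, 0, -1), 0), ((1, 0, 1, -1), 0), ((0, 1, 1, -1), 0),
      ((-1, 0, 0, 1), 1), ((0, -1, 0, 1), 1), ((0, 0, -1, 1), 1), ((-1, -1, -1, 1), 0)}"

lemma card_profile_halfspaces: "card profile_halfspaces = 7"
  by (simp add: profile_halfspaces_def)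

lemma profile_polytope_eq_halfspaces:
  "profile_polytope = {v. \<forall>(a, b)\<in>profile_halfspaces. a \<bullet> v \<le> b}"
  by (auto simp: profile_polytope_def profile_halfspaces_def)

lemma profile_polytope_facets:
  "{F. F facet_of profile_polytope} =
    (\<lambda>(a, b). profile_polytope \<inter> {v. a \<bullet> v = b}) ` profile_halfspaces"
  "card {F. F facet_of profile_polytope} = card profile_halfspaces"
proof -
  have fin: "finite profile_halfspaces"
    by (simp add: profile_halfspaces_def)
  \<comment> \<open>With x = y = z = 1/2 the inequalities are strict exactly for t between 1 and
    3/2.\<close>
  have q: "\<forall>(a, b)\<in>profile_halfspaces. a \<bullet> (1/2, 1/2, 1/2, 5/4) < b"
    by (simp add: profile_halfspaces_def)
  \<comment> \<open>Each inequality is paired with a point that violates it and satisfies the other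
    six.\<close>
  define W :: "(((real \<times> real \<times> real \<times> real) \<times> real) \<times> (real \<times> real \<times> real \<times> real)) set" where
    "W = {(((1, 1, 0, -1), 0), (0, 0, -1, -1)), (((1, 0, 1, -1), 0), (0, -1, 0, -1)),
      (((0, 1, 1, -1), 0), (-1, 0, 0, -1)), (((-1, 0, 0, 1), 1), (0, 1, 1, 2)),
      (((0, -1, 0, 1), 1), (1, 0, 1, 2)), (((0, 0, -1, 1), 1), (1, 1, 0, 2)),
      (((-1, -1, -1, 1), 0), (-1/2, -1/2, -1/2, -1/2))}"
  have W: "\<forall>((a, b), w)\<in>W. b < a \<bullet> w \<and>
      (\<forall>(a', b')\<in>profile_halfspaces. (a', b') = (a, b) \<or> a' \<bullet> w \<le> b')"
    unfolding W_def profile_halfspaces_def by simp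
  have W_halfspaces: "profile_halfspaces = fst ` W"
    by (simp add: profile_halfspaces_def W_def)
  have w: "\<exists>w. b < a \<bullet> w \<and> (\<forall>(a', b')\<in>profile_halfspaces - {(a, b)}. a' \<bullet> w \<le> b')"
    if "(a, b) \<in> profile_halfspaces" for a b
  proof -
    obtain w where "((a, b), w) \<in> W"
      using \<open>(a, b) \<in> profile_halfspaces\<close> unfolding W_halfspaces by auto
    with W show ?thesis
      by fastforce
  qed
  show "{F. F facet_of profile_polytope} =
      (\<lambda>(a, b). profile_polytope \<inter> {v. a \<bullet> v = b}) ` profile_halfspaces"
    "card {F. F facet_of profile_polytope} = card profile_halfspaces"
    using facets_of_irredundant_halfspaces[OF fin profile_polytope_eq_halfspaces q w] by auto
qed

section \<open>Vertices of the profile polytope\<close>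

definition profile_vertices :: "(real \<times> real \<times> real \<times> real) set" where
  "profile_vertices = {(0, 0, 0, 0), (1, 0, 0, 1), (0, 1, 0, 1), (0, 0, 1, 1), (1, 1, 1, 2),
     (1/2, 1/2, 1/2, 3/2)}"

lemma convex_profile_polytope: "convex profile_polytope"
  unfolding profile_polytope_eq_halfspaces
  by (auto simp: Collect_ball_eq case_prod_unfold intro!: convex_INT convex_halfspace_le)

text \<open>\<open>c\<close> is the weight of outcome 1 minus the weight of outcome 23; by symmetry of the constraints
  the same value arises from 2 and 13, and from 3 and 12. Its positive part is the weight of the
  origin, its negative part half the weight of the fractional vertex.\<close>

lemma profile_polytope_eq_hull: "profile_polytope = convex hull profile_vertices"
proof
  show "convex hull profile_vertices \<subseteq> profile_polytope"
    using convex_profile_polytope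
    by (intro hull_minimal) (auto simp: profile_vertices_def profile_polytope_def)
  show "profile_polytope \<subseteq> convex hull profile_vertices"
  proof
    fix v assume "v \<in> profile_polytope"
    then obtain x y z t where v: "v = (x, y, z, t)"
      and ineqs: "x + y \<le> t" "x + z \<le> t" "y + z \<le> t" "t \<le> 1 + x" "t \<le> 1 + y" "t \<le> 1 + z"
        "t \<le> x + y + z"
      by (auto simp: profile_polytope_def)
    define c where "c = 1 - 2 * t + x + y + z"
    define g where "g = max 0 c"
    define h where "h = max 0 (- c)"
    \<comment> \<open>Up to the correction \<open>h\<close>, the vertices with t = 1 carry the
      weights of outcomes 12, 13, 23, and (1, 1, 1, 2) that of 123. The halves in the fractional
      vertex give back the subtracted \<open>h\<close>.\<close>
    define u where
      "u = [g, t - y - z - h, t - x - z - h, t - x - y - h, x + y + z - t, 2 * h]"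
    define p :: "(real \<times> real \<times> real \<times> real) list" where
      "p = [(0, 0, 0, 0), (1, 0, 0, 1), (0, 1, 0, 1), (0, 0, 1, 1), (1, 1, 1, 2),
        (1/2, 1/2, 1/2, 3/2)]"
    have gh: "g - h = c"
      by (simp add: g_def h_def max_def)
    \<comment> \<open>\<open>- c\<close> is the weight of 23 minus that of 1, hence at most the
      former; likewise for the other two pairs.\<close>
    have h: "h \<le> t - y - z" "h \<le> t - x - z" "h \<le> t - x - y" "0 \<le> h" "0 \<le> g"
      using ineqs by (auto simp: h_def g_def c_def)
    have "(\<Sum>j<6. u ! j *\<^sub>R p ! j) \<in> convex hull profile_vertices"
    proof (rule convex_sum)
      show "(\<Sum>j<6. u ! j) = 1"
        using gh by (simp add: u_def eval_nat_numeral c_def)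
      show "0 \<le> u ! j" if "j \<in> {..<6}" for j
        using that h ineqs by (auto simp: u_def eval_nat_numeral less_Suc_eq)
      show "p ! j \<in> convex hull profile_vertices" if "j \<in> {..<6}" for j
        using that
        by (intro hull_inc) (auto simp: p_def profile_vertices_def eval_nat_numeral less_Suc_eq)
    qed auto
    moreover have "(\<Sum>j<6. u ! j *\<^sub>R p ! j) = v"
      by (simp add: v u_def p_def eval_nat_numeral)
    ultimately show "v \<in> convex hull profile_vertices"
      by simp
  qed
qed

text \<open>The supporting hyperplane cuts out the face consisting of \<open>v\<close>
  alone.\<close>

lemma extreme_point_of_unique_maximizer:
  fixes v :: "'a::real_inner"
  assumes "convex S" "v \<in> S" "\<And>x. x \<in> S \<Longrightarrow> a \<bullet> x \<le> a \<bullet> v"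
    and "\<And>x. x \<in> S \<Longrightarrow> a \<bullet> x = a \<bullet> v \<Longrightarrow> x = v"
  shows "v extreme_point_of S"
proof -
  have "S \<inter> {x. a \<bullet> x = a \<bullet> v} = {v}"
    using assms by auto
  then show ?thesis
    using face_of_Int_supporting_hyperplane_le[OF assms(1,3)] by (metis face_of_singleton)
qed

lemma profile_polytope_extreme_points:
  "{v. v extreme_point_of profile_polytope} = profile_vertices"
proof
  show "{v. v extreme_point_of profile_polytope} \<subseteq> profile_vertices"
    unfolding profile_polytope_eq_hull using extreme_point_of_convex_hull by blast
  \<comment> \<open>The first five functionals use the implied bounds t \<ge> 0 and 0 \<le> x, y, z
    \<le> 1. The last is the sum of the normals of the four inequalities tight at the fractional
    vertex.\<close>
  have "v extreme_point_of profile_polytope"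
    if "(v, a) \<in> {((0, 0, 0, 0), (0, 0, 0, -1)), ((1, 0, 0, 1), (1, -1, -1, 0)),
      ((0, 1, 0, 1), (-1, 1, -1, 0)), ((0, 0, 1, 1), (-1, -1, 1, 0)),
      ((1, 1, 1, 2), (1, 1, 1, 0)), ((1/2, 1/2, 1/2, 3/2), (-2, -2, -2, 4))}"
    for v a :: "real \<times> real \<times> real \<times> real"
  proof (rule extreme_point_of_unique_maximizer[OF convex_profile_polytope])
    show "v \<in> profile_polytope"
      using that by (elim insertE) (auto simp: profile_polytope_def)
    show "a \<bullet> x \<le> a \<bullet> v" if "x \<in> profile_polytope" for x
      using \<open>(v, a) \<in> _\<close> that by (elim insertE) (auto simp: profile_polytope_def)
    show "x = v" if "x \<in> profile_polytope" "a \<bullet> x = a \<bullet> v" for x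
      using \<open>(v, a) \<in> _\<close> that by (elim insertE) (auto simp: profile_polytope_def)
  qed
  then show "profile_vertices \<subseteq> {v. v extreme_point_of profile_polytope}"
    unfolding profile_vertices_def by blast
qed

theorem theorem5p2:
  shows "classical_region = gpt_region \<inter> {(x, y, z, t). t \<le> x + y + z}
    \<and> polytope classical_region
    \<and> (\<forall>(x, y, z, t) \<in> classical_region.
          t \<ge> x + y \<and> t \<ge> x + z \<and> t \<ge> y + z \<and>
          t \<le> 1 + x \<and> t \<le> 1 + y \<and> t \<le> 1 + z \<and> t \<le> x + y + z)
    \<and> {S. S facet_of classical_region} =
         {classical_region \<inter> {(x, y, z, t). t = x + y},
          classical_region \<inter> {(x, y, z, t). t = x + z},
          classical_region \<inter> {(x, y, z, t). t = y + z},
          classical_region \<inter> {(x, y, z, t). t = 1 + x},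
          classical_region \<inter> {(x, y, z, t). t = 1 + y},
          classical_region \<inter> {(x, y, z, t). t = 1 + z},
          classical_region \<inter> {(x, y, z, t). t = x + y + z}}
    \<and> card {S. S facet_of classical_region} = 7
    \<and> {v. v extreme_point_of classical_region} =
         {(0, 0, 0, 0), (1, 0, 0, 1), (0, 1, 0, 1), (0, 0, 1, 1), (1, 1, 1, 2),
          (1/2, 1/2, 1/2, 3/2)}"
proof (intro conjI)
  show "classical_region = gpt_region \<inter> {(x, y, z, t). t \<le> x + y + z}"
    using gpt_region_subset classical_region_subset profile_polytope_subset by blast
  show "polytope classical_region"
    unfolding classical_region_eq profile_polytope_eq_hull
    by (intro polytope_convex_hull) (simp add: profile_vertices_def)
  show "\<forall>(x, y, z, t) \<in> classical_region.
          t \<ge> x + y \<and> t \<ge> x + z \<and> t \<ge> y + z \<and>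
          t \<le> 1 + x \<and> t \<le> 1 + y \<and> t \<le> 1 + z \<and> t \<le> x + y + z"
    unfolding classical_region_eq profile_polytope_def by auto
  have eqs: "{v. (1, 1, 0, -1) \<bullet> v = 0} = {(x, y, z, t::real). t = x + y}"
    "{v. (1, 0, 1, -1) \<bullet> v = 0} = {(x, y, z, t::real). t = x + z}"
    "{v. (0, 1, 1, -1) \<bullet> v = 0} = {(x, y, z, t::real). t = y + z}"
    "{v. (-1, 0, 0, 1) \<bullet> v = 1} = {(x, y, z, t::real). t = 1 + x}"
    "{v. (0, -1, 0, 1) \<bullet> v = 1} = {(x, y, z, t::real). t = 1 + y}"
    "{v. (0, 0, -1, 1) \<bullet> v = 1} = {(x, y, z, t::real). t = 1 + z}"
    "{v. (-1, -1, -1, 1) \<bullet> v = 0} = {(x, y, z, t::real). t = x + y + z}"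
    by auto
  show "{S. S facet_of classical_region} =
         {classical_region \<inter> {(x, y, z, t). t = x + y},
          classical_region \<inter> {(x, y, z, t). t = x + z},
          classical_region \<inter> {(x, y, z, t). t = y + z},
          classical_region \<inter> {(x, y, z, t). t = 1 + x},
          classical_region \<inter> {(x, y, z, t). t = 1 + y},
          classical_region \<inter> {(x, y, z, t). t = 1 + z},
          classical_region \<inter> {(x, y, z, t). t = x + y + z}}"
    unfolding classical_region_eq profile_polytope_facets
    by (simp only: profile_halfspaces_def image_insert image_empty prod.case eqs)
  show "card {S. S facet_of classical_region} = 7"
    by (simp add: classical_region_eq profile_polytope_facets(2) card_profile_halfspaces)
  show "{v. v extreme_point_of classical_region} =
         {(0, 0, 0, 0), (1, 0, 0, 1), (0, 1, 0, 1), (0, 0, 1, 1), (1, 1, 1, 2),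
          (1/2, 1/2, 1/2, 3/2)}"
    unfolding classical_region_eq profile_polytope_extreme_points profile_vertices_def ..
qed

end
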